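(* Let $x \in \{com, prf, grd\}$. For may-must argumentations $F = (A,R,f_Q) \in \mathcal{F}$, neither $\Lambda^{maxi.x}_F \subseteq \Lambda^{adf.x}_F$ nor $\Lambda^{adf.x}_F \subseteq \Lambda^{maxi.x}_F$ generally holds; that is, for each such $x$ there is some $F \in \mathcal{F}$ with $\Lambda^{maxi.x}_F \not\subseteq \Lambda^{adf.x}_F$, and there is some $F \in \mathcal{F}$ with $\Lambda^{adf.x}_F \not\subseteq \Lambda^{maxi.x}_F$.
   Context: $\mathbb{N}$ includes $0$. $\mathcal{A}$ is a class of abstract entities called arguments. $\mathcal{L} = \{\mathsf{in}, \mathsf{out}, \mathsf{undec}\}$. $\Lambda$ is the class of all partial functions $\mathcal{A} \to \mathcal{L}$, and for $A \subseteq \mathcal{A}$, $\Lambda^A$ is the class of those $\lambda\in\Lambda$ defined exactly on $A$. For $\lambda_1,\lambda_2\in\Lambda$, $\lambda_1 \preceq \lambda_2$ iff there is a finite $A\subseteq\mathcal{A}$ with $\lambda_1,\lambda_2\in\Lambda^A$ and, for every $a \in A$, $\lambda_1(a)=\mathsf{in}$ implies $\lambda_2(a)=\mathsf{in}$ and $\lambda_1(a)=\mathsf{out}$ implies $\lambda_2(a)=\mathsf{out}$. $\lambda_1\prec\lambda_2$ means $\lambda_1\preceq\lambda_2$ and not $\lambda_2\preceq\lambda_1$. A may-must argumentation is a tuple $F = (A, R, f_Q)$ with $A \subseteq \mathcal{A}$ finite, $R \subseteq A \times A$ (the attack relation), and $f_Q : A \to (\mathbb{N}\times\mathbb{N})\times(\mathbb{N}\times\mathbb{N})$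 such that, writing $f_Q(a) = ((n_1^a, n_2^a),(m_1^a,m_2^a))$, one has $n_1^a \le n_2^a$ and $m_1^a \le m_2^a$ for every $a\in A$. $\mathcal{F}$ denotes the class of all may-must argumentations. For $a \in A$, $\mathsf{pred}^F(a) = \{a_x \in A \mid (a_x,a)\in R\}$; for $\lambda\in\Lambda$, $\mathsf{pred}^F_{\lambda,\mathsf{in}}(a)$ (resp. $\mathsf{pred}^F_{\lambda,\mathsf{out}}(a)$) is the set of those $a_x \in \mathsf{pred}^F(a)$ for which $\lambda$ is defined and $\lambda(a_x)=\mathsf{in}$ (resp. $\mathsf{out}$). Satisfaction (for $\lambda \in \Lambda$ and $a\in A$ for which $\lambda$ is defined), with $o = |\mathsf{pred}^F_{\lambda,\mathsf{out}}(a)|$ and $i=|\mathsf{pred}^F_{\lambda,\mathsf{in}}(a)|$: under $\lambda$ in $F$, $a$ satisfies may-a iff $n_1^a \le o$; must-a iff $n_2^a \le o$; may$_s$-a iff $n_1^a \le o < n_2^a$; not-a iff $o < n_1^a$; may-r iff $m_1^a \le i$; must-r iff $m_2^a \le i$; may$_s$-r iff $m_1^a \le i < m_2^a$; not-r iff $i < m_1^a$. Designation: $\lambda\in\Lambda$ designates $l \in \mathcal{L}$ for $a\in A$ (in $F$) iff (1) $\lambda$ is defined for every member of $\mathsf{pred}^F(a)$; (2) if $l=\mathsf{in}$, then $a$ satisfies may-a but not must-r; (3) if $l = \mathsf{out}$, then $a$ satisfies may-r but not must-a; (4) if $l=\mathsf{undec}$, then at least one of the following holds: $a$ satisfies both must-a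 and must-r; $a$ satisfies at least one of may$_s$-a, may$_s$-r; $a$ satisfies both not-a and not-r. Properness: $a$'s label is proper under $\lambda$ iff $\lambda$ is defined for $a$ and $\lambda$ designates $\lambda(a)$ for $a$. $\lambda$ is a pre-maximally proper labelling of $F$ iff $\lambda \in \Lambda^A$ and, for every $a \in A$, either $a$'s label is proper under $\lambda$ or $\lambda(a)=\mathsf{undec}$. A pre-maximally proper labelling $\lambda$ of $F$ is maximally proper iff, for every pre-maximally proper labelling $\lambda_x$ of $F$ and every $a\in A$, if $a$'s label is proper under $\lambda_x$, then $a$'s label is proper under $\lambda$. $\Lambda^{maxi.com}_F$ is the set of all maximally proper labellings of $F$. $\Lambda^{maxi.prf}_F$ is the set of all maxi.preferred labellings: those $\lambda\in\Lambda^{maxi.com}_F$ for which there is no $\lambda'\in\Lambda^{maxi.com}_F$ with $\lambda\prec\lambda'$. $\Lambda^{maxi.grd}_F$ is the set of all maxi.grounded labellings: those $\lambda$ that are the meet (greatest lower bound) of $\Lambda^{maxi.com}_F$ in $(\Lambda^A,\preceq)$. ADF semantics for $F=(A,R,f_Q)\in\mathcal{F}$: for $\lambda\in\Lambda^A$ let $\mathsf{twoVal}_A(\lambda) = \{\lambda_x \in\Lambda^A \mid \lambda\preceq\lambda_x \text{ and } \lambda_x \text{ is maximal in } (\Lambda^A,\preceq)\}$ (so members take only values $\mathsf{in},\mathsf{out}$). Define $\Gamma^F:\Lambda^A\to\Lambda^A$ by: for $a \in A$ and $l\in\{\mathsf{in},\mathsf{out}\}$, $\Gamma^F(\lambda)(a)=l$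 iff every $\lambda_x\in\mathsf{twoVal}_A(\lambda)$ designates only $l$ for $a$ in $F$; otherwise $\Gamma^F(\lambda)(a)=\mathsf{undec}$. $\Lambda^{adf.com}_F$ is the set of all fixpoints of $\Gamma^F$; $\Lambda^{adf.prf}_F$ is the set of all maximal elements of $(\Lambda^{adf.com}_F,\preceq)$; $\Lambda^{adf.grd}_F$ is the set consisting of the least fixpoint of $\Gamma^F$ with respect to $\preceq$. *)

theory Defs
  imports Main
begin

datatype label = In | Out | Undec

text \<open>The class of arguments is the type variable \<^typ>\<open>'a\<close>, and \<open>\<Lambda>\<close> is the type
  of partial functions \<open>'a \<rightharpoonup> label\<close>.\<close>

type_synonym 'a labelling = "'a \<rightharpoonup> label"

definition labellings_on :: "'a set \<Rightarrow> 'a labelling set" where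
  "labellings_on A = {lab. dom lab = A}"

definition lab_le :: "'a labelling \<Rightarrow> 'a labelling \<Rightarrow> bool" (infix "\<preceq>" 50) where
  "l1 \<preceq> l2 \<longleftrightarrow> (\<exists>A. finite A \<and> l1 \<in> labellings_on A \<and> l2 \<in> labellings_on A \<and>
     (\<forall>a\<in>A. (l1 a = Some In \<longrightarrow> l2 a = Some In) \<and> (l1 a = Some Out \<longrightarrow> l2 a = Some Out)))"

definition lab_less :: "'a labelling \<Rightarrow> 'a labelling \<Rightarrow> bool" (infix "\<prec>" 50) where
  "l1 \<prec> l2 \<longleftrightarrow> l1 \<preceq> l2 \<and> \<not> l2 \<preceq> l1"

definition maximal_elements :: "'a labelling set \<Rightarrow> 'a labelling set" where
  "maximal_elements S = {lab \<in> S. \<not> (\<exists>lab'\<in>S. lab \<prec> lab')}"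

definition least_elements :: "'a labelling set \<Rightarrow> 'a labelling set" where
  "least_elements S = {lab \<in> S. \<forall>lab'\<in>S. lab \<preceq> lab'}"

definition is_meet_on :: "'a set \<Rightarrow> 'a labelling set \<Rightarrow> 'a labelling \<Rightarrow> bool" where
  "is_meet_on A S lab \<longleftrightarrow>
     lab \<in> labellings_on A \<and> (\<forall>l\<in>S. lab \<preceq> l) \<and>
     (\<forall>lb\<in>labellings_on A. (\<forall>l\<in>S. lb \<preceq> l) \<longrightarrow> lb \<preceq> lab)"

text \<open>The scale function \<open>scales\<close> is total on the type; only its values on \<open>args\<close> matter.\<close>

record 'a argumentation =
  args :: "'a set"
  att :: "('a \<times> 'a) set"
  scales :: "'a \<Rightarrow> (nat \<times> nat) \<times> (nat \<times> nat)"

definition n1 :: "'a argumentation \<Rightarrow> 'a \<Rightarrow> nat" where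
  "n1 F a = fst (fst (scales F a))"

definition n2 :: "'a argumentation \<Rightarrow> 'a \<Rightarrow> nat" where
  "n2 F a = snd (fst (scales F a))"

definition m1 :: "'a argumentation \<Rightarrow> 'a \<Rightarrow> nat" where
  "m1 F a = fst (snd (scales F a))"

definition m2 :: "'a argumentation \<Rightarrow> 'a \<Rightarrow> nat" where
  "m2 F a = snd (snd (scales F a))"

definition may_must_argumentation :: "'a argumentation \<Rightarrow> bool" where
  "may_must_argumentation F \<longleftrightarrow>
     finite (args F) \<and> att F \<subseteq> args F \<times> args F \<and>
     (\<forall>a\<in>args F. n1 F a \<le> n2 F a \<and> m1 F a \<le> m2 F a)"

definition pred :: "'a argumentation \<Rightarrow> 'a \<Rightarrow> 'a set" where
  "pred F a = {b \<in> args F. (b, a) \<in> att F}"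

definition pred_labelled :: "'a argumentation \<Rightarrow> 'a labelling \<Rightarrow> label \<Rightarrow> 'a \<Rightarrow> 'a set" where
  "pred_labelled F lab l a = {b \<in> pred F a. lab b = Some l}"

definition num_out :: "'a argumentation \<Rightarrow> 'a labelling \<Rightarrow> 'a \<Rightarrow> nat" where
  "num_out F lab a = card (pred_labelled F lab Out a)"

definition num_in :: "'a argumentation \<Rightarrow> 'a labelling \<Rightarrow> 'a \<Rightarrow> nat" where
  "num_in F lab a = card (pred_labelled F lab In a)"

text \<open>Satisfaction is meant for arguments on which the labelling is defined. The predicates
  below carry no such guard: the semantics use them only for labellings defined on all of
  \<open>args F\<close>.\<close>

definition may_a :: "'a argumentation \<Rightarrow> 'a labelling \<Rightarrow> 'a \<Rightarrow> bool" where
  "may_a F lab a \<longleftrightarrow> n1 F a \<le> num_out F lab a"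

definition must_a :: "'a argumentation \<Rightarrow> 'a labelling \<Rightarrow> 'a \<Rightarrow> bool" where
  "must_a F lab a \<longleftrightarrow> n2 F a \<le> num_out F lab a"

definition may_s_a :: "'a argumentation \<Rightarrow> 'a labelling \<Rightarrow> 'a \<Rightarrow> bool" where
  "may_s_a F lab a \<longleftrightarrow> n1 F a \<le> num_out F lab a \<and> num_out F lab a < n2 F a"

definition not_a :: "'a argumentation \<Rightarrow> 'a labelling \<Rightarrow> 'a \<Rightarrow> bool" where
  "not_a F lab a \<longleftrightarrow> num_out F lab a < n1 F a"

definition may_r :: "'a argumentation \<Rightarrow> 'a labelling \<Rightarrow> 'a \<Rightarrow> bool" where
  "may_r F lab a \<longleftrightarrow> m1 F a \<le> num_in F lab a"

definition must_r :: "'a argumentation \<Rightarrow> 'a labelling \<Rightarrow> 'a \<Rightarrow> bool" where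
  "must_r F lab a \<longleftrightarrow> m2 F a \<le> num_in F lab a"

definition may_s_r :: "'a argumentation \<Rightarrow> 'a labelling \<Rightarrow> 'a \<Rightarrow> bool" where
  "may_s_r F lab a \<longleftrightarrow> m1 F a \<le> num_in F lab a \<and> num_in F lab a < m2 F a"

definition not_r :: "'a argumentation \<Rightarrow> 'a labelling \<Rightarrow> 'a \<Rightarrow> bool" where
  "not_r F lab a \<longleftrightarrow> num_in F lab a < m1 F a"

definition designates :: "'a argumentation \<Rightarrow> 'a labelling \<Rightarrow> label \<Rightarrow> 'a \<Rightarrow> bool" where
  "designates F lab l a \<longleftrightarrow>
     pred F a \<subseteq> dom lab \<and>
     (l = In \<longrightarrow> may_a F lab a \<and> \<not> must_r F lab a) \<and>
     (l = Out \<longrightarrow> may_r F lab a \<and> \<not> must_a F lab a) \<and>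
     (l = Undec \<longrightarrow>
        (must_a F lab a \<and> must_r F lab a) \<or>
        (may_s_a F lab a \<or> may_s_r F lab a) \<or>
        (not_a F lab a \<and> not_r F lab a))"

definition label_proper :: "'a argumentation \<Rightarrow> 'a labelling \<Rightarrow> 'a \<Rightarrow> bool" where
  "label_proper F lab a \<longleftrightarrow> (\<exists>l. lab a = Some l \<and> designates F lab l a)"

definition pre_maximally_proper :: "'a argumentation \<Rightarrow> 'a labelling \<Rightarrow> bool" where
  "pre_maximally_proper F lab \<longleftrightarrow>
     lab \<in> labellings_on (args F) \<and>
     (\<forall>a\<in>args F. label_proper F lab a \<or> lab a = Some Undec)"

definition maximally_proper :: "'a argumentation \<Rightarrow> 'a labelling \<Rightarrow> bool" where
  "maximally_proper F lab \<longleftrightarrow>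
     pre_maximally_proper F lab \<and>
     (\<forall>lab'. pre_maximally_proper F lab' \<longrightarrow>
        (\<forall>a\<in>args F. label_proper F lab' a \<longrightarrow> label_proper F lab a))"

definition maxi_com :: "'a argumentation \<Rightarrow> 'a labelling set" where
  "maxi_com F = {lab. maximally_proper F lab}"

definition maxi_prf :: "'a argumentation \<Rightarrow> 'a labelling set" where
  "maxi_prf F = maximal_elements (maxi_com F)"

definition maxi_grd :: "'a argumentation \<Rightarrow> 'a labelling set" where
  "maxi_grd F = {lab. is_meet_on (args F) (maxi_com F) lab}"

definition two_val :: "'a set \<Rightarrow> 'a labelling \<Rightarrow> 'a labelling set" where
  "two_val A lab = {lab'. lab \<preceq> lab' \<and> lab' \<in> maximal_elements (labellings_on A)}"

definition designates_only :: "'a argumentation \<Rightarrow> 'a labelling \<Rightarrow> label \<Rightarrow> 'a \<Rightarrow> bool" where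
  "designates_only F lab l a \<longleftrightarrow> designates F lab l a \<and> (\<forall>l'. designates F lab l' a \<longrightarrow> l' = l)"

definition adf_Gamma :: "'a argumentation \<Rightarrow> 'a labelling \<Rightarrow> 'a labelling" where
  "adf_Gamma F lab = (\<lambda>a.
     if a \<notin> args F then None
     else if \<forall>lab'\<in>two_val (args F) lab. designates_only F lab' In a then Some In
     else if \<forall>lab'\<in>two_val (args F) lab. designates_only F lab' Out a then Some Out
     else Some Undec)"

definition adf_com :: "'a argumentation \<Rightarrow> 'a labelling set" where
  "adf_com F = {lab \<in> labellings_on (args F). adf_Gamma F lab = lab}"

definition adf_prf :: "'a argumentation \<Rightarrow> 'a labelling set" where
  "adf_prf F = maximal_elements (adf_com F)"

definition adf_grd :: "'a argumentation \<Rightarrow> 'a labelling set" where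
  "adf_grd F = least_elements (adf_com F)"

text \<open>The order of the tests in \<^const>\<open>adf_Gamma\<close> is immaterial, since \<^const>\<open>two_val\<close>
  is never empty on labellings of a finite set.\<close>

lemma two_val_nonempty:
  assumes "finite A" "lab \<in> labellings_on A"
  shows "two_val A lab \<noteq> {}"
proof -
  define lab' where
    "lab' = (\<lambda>a. if lab a = Some Undec then Some In else lab a)"
  have d: "dom lab = A" using assms(2) by (simp add: labellings_on_def)
  have d': "dom lab' = A" unfolding d[symmetric] by (auto simp: lab'_def dom_def)
  have nu: "lab' a = Some In \<or> lab' a = Some Out" if a: "a \<in> A" for a
  proof -
    obtain l where "lab a = Some l" using a d by blast
    then show ?thesis by (cases l) (auto simp: lab'_def)
  qed
  have "lab \<preceq> lab'"
    unfolding lab_le_def using assms d d' by (auto simp: labellings_on_def lab'_def)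
  moreover have "\<not> lab' \<prec> l2" if "l2 \<in> labellings_on A" for l2
  proof
    assume "lab' \<prec> l2"
    then have le: "lab' \<preceq> l2" and nle: "\<not> l2 \<preceq> lab'" by (auto simp: lab_less_def)
    have "l2 a = lab' a" if "a \<in> A" for a
      using le nu[OF that] that d' by (auto simp: lab_le_def labellings_on_def)
    then have "l2 \<preceq> lab'"
      unfolding lab_le_def using assms(1) that d' by (auto simp: labellings_on_def)
    with nle show False by simp
  qed
  ultimately have "lab' \<in> two_val A lab"
    using d' by (auto simp: two_val_def maximal_elements_def labellings_on_def)
  then show ?thesis by blast
qed

lemma adf_Gamma_iff:
  assumes "may_must_argumentation F" "lab \<in> labellings_on (args F)" "a \<in> args F"
  shows "l \<in> {In, Out} \<Longrightarrow>
      adf_Gamma F lab a = Some l \<longleftrightarrow> (\<forall>lab'\<in>two_val (args F) lab. designates_only F lab' l a)"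
    and "adf_Gamma F lab a = Some Undec \<longleftrightarrow>
      \<not> (\<exists>l\<in>{In, Out}. \<forall>lab'\<in>two_val (args F) lab. designates_only F lab' l a)"
proof -
  obtain l0 where l0: "l0 \<in> two_val (args F) lab"
    using two_val_nonempty[of "args F" lab] assms by (auto simp: may_must_argumentation_def)
  have ex: "\<not> ((\<forall>lab'\<in>two_val (args F) lab. designates_only F lab' In a) \<and>
                (\<forall>lab'\<in>two_val (args F) lab. designates_only F lab' Out a))"
    using l0 by (auto simp: designates_only_def)
  show "l \<in> {In, Out} \<Longrightarrow>
      adf_Gamma F lab a = Some l \<longleftrightarrow> (\<forall>lab'\<in>two_val (args F) lab. designates_only F lab' l a)"
    using ex assms(3) unfolding adf_Gamma_def by (cases l) auto
  show "adf_Gamma F lab a = Some Undec \<longleftrightarrow>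
      \<not> (\<exists>l\<in>{In, Out}. \<forall>lab'\<in>two_val (args F) lab. designates_only F lab' l a)"
    using assms(3) unfolding adf_Gamma_def by simp
qed

datatype semantics = Com | Prf | Grd

fun maxi_labellings :: "semantics \<Rightarrow> 'a argumentation \<Rightarrow> 'a labelling set" where
  "maxi_labellings Com F = maxi_com F"
| "maxi_labellings Prf F = maxi_prf F"
| "maxi_labellings Grd F = maxi_grd F"

fun adf_labellings :: "semantics \<Rightarrow> 'a argumentation \<Rightarrow> 'a labelling set" where
  "adf_labellings Com F = adf_com F"
| "adf_labellings Prf F = adf_prf F"
| "adf_labellings Grd F = adf_grd F"

end

(* Let the only argument a attack itself, with scales n1 = n2 = 0, m1 = 1, m2 = 2. Acceptance is
   always obliged, while rejection is permitted exactly when a is labelled In. So In is designated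
   under every labelling, and Undec is designated only under In: In is the unique maximally
   proper labelling. Gamma, however, needs In to be the only designated label, which fails under
   the two-valued labelling In, so Undec is the unique fixpoint of Gamma. *)
theory Submission
  imports Defs
begin

lemma labellings_on_singleton: "lab \<in> labellings_on {a} \<longleftrightarrow> (\<exists>l. lab = [a \<mapsto> l])"
  by (auto simp: labellings_on_def dom_eq_singleton_conv)

lemma lab_le_singleton: "[a \<mapsto> l] \<preceq> [a \<mapsto> l'] \<longleftrightarrow> l = Undec \<or> l = l'"
  by (cases l; cases l') (auto simp: lab_le_def labellings_on_def)

lemma lab_le_refl: "finite (dom lab) \<Longrightarrow> lab \<preceq> lab"
  by (auto simp: lab_le_def labellings_on_def)

text \<open>The order compares only \<open>In\<close> and \<open>Out\<close>, but agreement on both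
  leaves \<open>Undec\<close> as the sole remaining value.\<close>

lemma lab_le_antisym:
  assumes "l1 \<preceq> l2" "l2 \<preceq> l1"
  shows "l1 = l2"
proof (rule ext)
  fix a
  have dom: "dom l1 = dom l2"
    using assms(1) by (auto simp: lab_le_def labellings_on_def)
  have in_out: "l1 a = Some In \<longleftrightarrow> l2 a = Some In" "l1 a = Some Out \<longleftrightarrow> l2 a = Some Out"
    if "a \<in> dom l1"
    using assms that unfolding lab_le_def labellings_on_def by blast+
  show "l1 a = l2 a"
  proof (cases "a \<in> dom l1")
    case True
    with dom obtain u v where uv: "l1 a = Some u" "l2 a = Some v"
      by blast
    then have "u = In \<longleftrightarrow> v = In" "u = Out \<longleftrightarrow> v = Out"
      using in_out[OF True] by simp_all
    then have "u = v"
      by (metis label.exhaust)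
    with uv show ?thesis
      by simp
  next
    case False
    with dom show ?thesis
      by (metis domIff)
  qed
qed

lemma maximal_elements_singleton: "maximal_elements {lab} = {lab}"
  by (auto simp: maximal_elements_def lab_less_def)

lemma least_elements_singleton: "finite (dom lab) \<Longrightarrow> least_elements {lab} = {lab}"
  by (auto simp: least_elements_def lab_le_refl)

text \<open>Since \<open>lab\<close> is itself a lower bound of \<open>{lab}\<close>, any meet lies
  both below and above it, and antisymmetry applies.\<close>

lemma is_meet_on_singleton:
  assumes "finite (dom lab)"
  shows "is_meet_on (dom lab) {lab} lab' \<longleftrightarrow> lab' = lab"
proof -
  have "lab \<in> labellings_on (dom lab)" "lab \<preceq> lab"
    using assms by (simp_all add: labellings_on_def lab_le_refl)
  then show ?thesis
    unfolding is_meet_on_def using lab_le_antisym[of lab' lab] by blast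
qed

text \<open>On one argument the order is flat: a decided label has only itself as completion, while
  \<open>Undec\<close> has both. This reduces evaluating \<open>adf_Gamma\<close> to at most two
  checks.\<close>

lemma ball_two_val_singleton:
  "(\<forall>lab\<in>two_val {a} [a \<mapsto> l]. P lab) \<longleftrightarrow> (l \<noteq> Out \<longrightarrow> P [a \<mapsto> In]) \<and> (l \<noteq> In \<longrightarrow> P [a \<mapsto> Out])"
proof -
  \<comment> \<open>Keeping the map update opaque lets \<open>labs\<close> and \<open>le\<close>
    turn quantifiers over labellings into quantifiers over labels.\<close>
  define f where "f l = [a \<mapsto> l]" for l :: label
  have labs: "labellings_on {a} = range f"
    unfolding set_eq_iff labellings_on_singleton f_def image_iff by simp
  have le: "f l1 \<preceq> f l2 \<longleftrightarrow> l1 = Undec \<or> l1 = l2" for l1 l2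
    by (simp add: f_def lab_le_singleton)
  have total: "l' \<noteq> Undec \<longleftrightarrow> \<not> (\<exists>lab\<in>labellings_on {a}. f l' \<prec> lab)" for l'
    by (auto simp: labs lab_less_def le)
  have "(\<forall>lab\<in>two_val {a} (f l). P lab) \<longleftrightarrow> (\<forall>l'. f l \<preceq> f l' \<and> l' \<noteq> Undec \<longrightarrow> P (f l'))"
    unfolding two_val_def maximal_elements_def total by (auto simp: labs)
  also have "\<dots> \<longleftrightarrow> (l \<noteq> Out \<longrightarrow> P (f In)) \<and> (l \<noteq> In \<longrightarrow> P (f Out))"
    unfolding le by (metis label.exhaust label.distinct)
  finally show ?thesis
    by (simp add: f_def)
qed

definition self_attack :: "'a \<Rightarrow> 'a argumentation" where
  "self_attack a = \<lparr>args = {a}, att = {(a, a)}, scales = (\<lambda>_. ((0, 0), (1, 2)))\<rparr>"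

lemma args_self_attack [simp]: "args (self_attack a) = {a}"
  by (simp add: self_attack_def)

lemma may_must_argumentation_self_attack: "may_must_argumentation (self_attack a)"
  by (simp add: may_must_argumentation_def self_attack_def n1_def n2_def m1_def m2_def)

lemma designates_self_attack:
  "designates (self_attack a) [a \<mapsto> l] l' a \<longleftrightarrow> l' = In \<or> l' = Undec \<and> l = In"
proof -
  have "pred (self_attack a) a = {a}"
    by (auto simp: pred_def self_attack_def)
  then have "num_in (self_attack a) [a \<mapsto> l] a = (if l = In then 1 else 0)"
    by (auto simp: num_in_def pred_labelled_def)
  then show ?thesis
    using \<open>pred (self_attack a) a = {a}\<close>
    by (cases l') (auto simp: designates_def may_a_def must_a_def may_s_a_def not_a_def may_r_def
        must_r_def may_s_r_def not_r_def n1_def n2_def m1_def m2_def self_attack_def)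
qed

lemma maxi_com_self_attack: "maxi_com (self_attack a) = {[a \<mapsto> In]}"
proof -
  have proper: "label_proper (self_attack a) [a \<mapsto> l] a \<longleftrightarrow> l = In" for l
    by (auto simp: label_proper_def designates_self_attack)
  have pre: "pre_maximally_proper (self_attack a) lab \<longleftrightarrow> lab = [a \<mapsto> In] \<or> lab = [a \<mapsto> Undec]"
    for lab
    by (auto simp: pre_maximally_proper_def labellings_on_singleton proper)
  show ?thesis
    by (auto simp: maxi_com_def maximally_proper_def pre proper)
qed

lemma adf_com_self_attack: "adf_com (self_attack a) = {[a \<mapsto> Undec]}"
proof -
  \<comment> \<open>Unless \<open>l = Out\<close>, the completion labelling \<open>a\<close> with
    \<open>In\<close> is present, and it designates \<open>Undec\<close> besides
    \<open>In\<close>.\<close>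
  have "adf_Gamma (self_attack a) [a \<mapsto> l] = [a \<mapsto> if l = Out then In else Undec]" for l
    by (cases l) (auto simp: adf_Gamma_def ball_two_val_singleton designates_only_def
        designates_self_attack fun_eq_iff)
  then show ?thesis
    by (auto simp: adf_com_def labellings_on_singleton dest: map_upd_eqD1 split: if_splits)
qed

text \<open>With a single maximally proper labelling, that labelling is also the only maximal one
  and the meet.\<close>

lemma maxi_labellings_self_attack: "maxi_labellings x (self_attack a) = {[a \<mapsto> In]}"
  by (cases x) (auto simp: maxi_com_self_attack maxi_prf_def maximal_elements_singleton
      maxi_grd_def is_meet_on_singleton[of "[a \<mapsto> In]", simplified])

lemma adf_labellings_self_attack: "adf_labellings x (self_attack a) = {[a \<mapsto> Undec]}"
  by (cases x) (auto simp: adf_com_self_attack adf_prf_def maximal_elements_singleton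
      adf_grd_def least_elements_singleton)

theorem corollary1:
  fixes x :: semantics
  shows "(\<exists>F :: 'a argumentation. may_must_argumentation F \<and>
            \<not> maxi_labellings x F \<subseteq> adf_labellings x F) \<and>
         (\<exists>F :: 'a argumentation. may_must_argumentation F \<and>
            \<not> adf_labellings x F \<subseteq> maxi_labellings x F)"
proof -
  \<comment> \<open>Types are inhabited, so an argument exists in every \<open>'a\<close>; one
    framework then refutes both inclusions, as the two sets are distinct singletons.\<close>
  fix a :: 'a
  have "[a \<mapsto> In] \<noteq> [a \<mapsto> Undec]"
    by (blast dest: map_upd_eqD1)
  then have "\<not> maxi_labellings x (self_attack a) \<subseteq> adf_labellings x (self_attack a)"
    and "\<not> adf_labellings x (self_attack a) \<subseteq> maxi_labellings x (self_attack a)"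
    unfolding maxi_labellings_self_attack adf_labellings_self_attack subset_singleton_iff
    by (metis insert_not_empty singleton_insert_inj_eq')+
  then show ?thesis
    using may_must_argumentation_self_attack[of a] by (intro conjI exI[of _ "self_attack a"])
qed

end
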